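(* Let $k\ge 3$ be odd and let $G$ be an odd unicycle graph of girth $k$ whose Grover walk is periodic with odd period, whose unique cycle has vertices $u,u_1,\dots,u_{k-1}$ with $\deg u=4$ and $\deg u_i=2$ for $1\le i\le k-1$. Let $v_1,w_1$ be the two neighbours of $u$ off the cycle, let $t\ge1$, and suppose $v_1,\dots,v_t$ and $w_1,\dots,w_t$ are defined (as in the context) with $\deg v_1=\dots=\deg v_t=2$ and $\deg w_1=\dots=\deg w_t=2$. Then either $\deg v_{t+1}=\deg w_{t+1}=1$ or $\deg v_{t+1}=\deg w_{t+1}=2$.
   Context: Graphs are simple, connected and finite. An odd unicycle graph is a non-bipartite graph with $|V|=|E|$, i.e. a connected graph with exactly one cycle, of odd length (its girth). Grover walk: with arcs $\mathcal{A}=\{(a,b),(b,a)\mid ab\in E\}$, $o((a,b))=a$, $t((a,b))=b$, $\overline{(a,b)}=(b,a)$, the time evolution $U$ on $\mathbb{C}^{\mathcal{A}}$ has $U_{e,f}=2/\deg t(f)$ if $t(f)=o(e)$, $e\neq\bar f$; $U_{e,f}=2/\deg t(f)-1$ if $e=\bar f$; $0$ otherwise; periodic means $U^m=I$ for some $m\ge1$, the least such $m$ being the period. Set $v_0=w_0=u$; recursively, if $v_{j-1}$ ($j\ge2$) is defined and has degree 2, $v_j$ is its neighbour other than $v_{j-2}$; similarly for $w_j$. (Thus, under the hypothesis, $v_{t+1}$ and $w_{t+1}$ are well defined.) *)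

theory Defs
  imports Complex_Main
begin

definition simple_graph :: "'a set \<Rightarrow> ('a \<Rightarrow> 'a \<Rightarrow> bool) \<Rightarrow> bool" where
  "simple_graph V E \<longleftrightarrow> finite V \<and>
     (\<forall>x y. E x y \<longrightarrow> x \<in> V \<and> y \<in> V \<and> x \<noteq> y \<and> E y x)"

definition connected_graph :: "'a set \<Rightarrow> ('a \<Rightarrow> 'a \<Rightarrow> bool) \<Rightarrow> bool" where
  "connected_graph V E \<longleftrightarrow> V \<noteq> {} \<and> (\<forall>x\<in>V. \<forall>y\<in>V. E\<^sup>*\<^sup>* x y)"

definition edges :: "('a \<Rightarrow> 'a \<Rightarrow> bool) \<Rightarrow> 'a set set" where
  "edges E = {{x, y} | x y. E x y}"

definition bipartite :: "'a set \<Rightarrow> ('a \<Rightarrow> 'a \<Rightarrow> bool) \<Rightarrow> bool" where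
  "bipartite V E \<longleftrightarrow> (\<exists>S. \<forall>x y. E x y \<longrightarrow> (x \<in> S \<longleftrightarrow> y \<notin> S))"

definition deg :: "('a \<Rightarrow> 'a \<Rightarrow> bool) \<Rightarrow> 'a \<Rightarrow> nat" where
  "deg E x = card {y. E x y}"

definition odd_unicycle :: "'a set \<Rightarrow> ('a \<Rightarrow> 'a \<Rightarrow> bool) \<Rightarrow> bool" where
  "odd_unicycle V E \<longleftrightarrow> simple_graph V E \<and> connected_graph V E \<and>
     card V = card (edges E) \<and> \<not> bipartite V E"

text \<open>Arcs (a,b) with ab an edge; o = fst, t = snd, reversal = prod.swap.\<close>
definition arcs :: "('a \<Rightarrow> 'a \<Rightarrow> bool) \<Rightarrow> ('a \<times> 'a) set" where
  "arcs E = {(a, b). E a b}"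

definition grover :: "('a \<Rightarrow> 'a \<Rightarrow> bool) \<Rightarrow> ('a \<times> 'a) \<Rightarrow> ('a \<times> 'a) \<Rightarrow> complex" where
  "grover E e f =
     (if e = prod.swap f then 2 / of_nat (deg E (snd f)) - 1
      else if snd f = fst e then 2 / of_nat (deg E (snd f))
      else 0)"

definition mat_mult :: "'b set \<Rightarrow> ('b \<Rightarrow> 'b \<Rightarrow> complex) \<Rightarrow> ('b \<Rightarrow> 'b \<Rightarrow> complex) \<Rightarrow> 'b \<Rightarrow> 'b \<Rightarrow> complex" where
  "mat_mult I M N = (\<lambda>e f. \<Sum>g\<in>I. M e g * N g f)"

definition mat_id :: "'b \<Rightarrow> 'b \<Rightarrow> complex" where
  "mat_id = (\<lambda>e f. if e = f then 1 else 0)"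

fun mat_pow :: "'b set \<Rightarrow> ('b \<Rightarrow> 'b \<Rightarrow> complex) \<Rightarrow> nat \<Rightarrow> 'b \<Rightarrow> 'b \<Rightarrow> complex" where
  "mat_pow I M 0 = mat_id"
| "mat_pow I M (Suc n) = mat_mult I M (mat_pow I M n)"

definition grover_power_id :: "('a \<Rightarrow> 'a \<Rightarrow> bool) \<Rightarrow> nat \<Rightarrow> bool" where
  "grover_power_id E m \<longleftrightarrow>
     (\<forall>e\<in>arcs E. \<forall>f\<in>arcs E. mat_pow (arcs E) (grover E) m e f = mat_id e f)"

definition grover_periodic :: "('a \<Rightarrow> 'a \<Rightarrow> bool) \<Rightarrow> bool" where
  "grover_periodic E \<longleftrightarrow> (\<exists>m\<ge>1. grover_power_id E m)"

definition grover_period :: "('a \<Rightarrow> 'a \<Rightarrow> bool) \<Rightarrow> nat" where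
  "grover_period E = (LEAST m. m \<ge> 1 \<and> grover_power_id E m)"

end

theory Submission
  imports Defs "HOL-Computational_Algebra.Primes"
begin

text \<open>Write \<open>k = 2 h + 1\<close> and start the walk \<open>U\<close> with unit amplitude on both arcs of the cycle
  edge \<open>pq\<close> opposite to \<open>u\<close>; by reflection symmetry both arcs always carry the same amplitude
  \<open>\<alpha>\<^sub>n\<close>. Removing \<open>pq\<close> leaves a tree, and conjugating \<open>U\<close> by its bipartition signs gives \<open>-U\<close>
  except on these two arcs. Hence the even part of \<open>A(z) = \<Sum> \<alpha>\<^sub>n z\<^sup>n\<close> equals \<open>A(z) A(-z)\<close>. By
  periodicity the rational numbers \<open>\<alpha>\<^sub>n\<close> have bounded denominators, and then this identity forces
  them to be integers. The symmetric pulse passes through \<open>u\<close> into both branches without loss, is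
  partially reflected at \<open>v\<^sub>t\<^sub>+\<^sub>1\<close> and \<open>w\<^sub>t\<^sub>+\<^sub>1\<close>, and comes back to \<open>pq\<close> at time \<open>n = k + 2 (t + 1)\<close> with
  \<open>\<alpha>\<^sub>n = 1 / deg v\<^sub>t\<^sub>+\<^sub>1 + 1 / deg w\<^sub>t\<^sub>+\<^sub>1 - 1\<close>, which is an integer only for degrees
  \<open>(1, 1)\<close> and \<open>(2, 2)\<close>.\<close>

section \<open>Integrality of power series with bounded denominators\<close>

lemma common_denominator:
  assumes "finite A" "A \<subseteq> (\<rat> :: complex set)"
  shows "\<exists>D::nat. D > 0 \<and> (\<forall>x\<in>A. of_nat D * x \<in> \<int>)"
  using assms
proof (induction A rule: finite_induct)
  case empty
  then show ?case by auto
next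
  case (insert x A)
  then obtain D :: nat where D: "D > 0" "\<forall>x\<in>A. of_nat D * x \<in> \<int>" by auto
  from insert.prems have "x \<in> \<rat>" by simp
  then obtain a b :: int where ab: "b > 0" "x = of_int a / of_int b"
    by (auto elim: Rats_cases')
  have "of_nat (nat b) = (of_int b :: complex)" using ab by simp
  then have x: "of_nat (nat b) * x \<in> \<int>" using ab by simp
  have "of_nat (D * nat b) * y \<in> \<int>" if "y \<in> insert x A" for y
  proof (cases "y = x")
    case True
    have "of_nat (D * nat b) * x = of_nat D * (of_nat (nat b) * x)" by simp
    with x True show ?thesis by (metis Ints_mult Ints_of_nat)
  next
    case False
    have "of_nat (D * nat b) * y = of_nat (nat b) * (of_nat D * y)" by simp
    with D False that show ?thesis by (metis Ints_mult Ints_of_nat insertE)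
  qed
  moreover have "D * nat b > 0" using D ab by simp
  ultimately show ?case by blast
qed

text \<open>With \<open>A(z) = \<Sum> a i z ^ i\<close>, the hypothesis says that the even part of \<open>A(z)\<close> is
  \<open>A(z) A(-z)\<close>. The Gauss norm of a power series with bounded denominators is
  multiplicative, so \<open>\<bar>A\<bar>\<^sup>2 \<le> \<bar>A\<bar>\<close> at every prime.\<close>

lemma integral_of_even_part_eq:
  fixes a :: "nat \<Rightarrow> complex"
  assumes rat: "range a \<subseteq> \<rat>" and fin: "finite (range a)"
    and eq: "\<And>j. a (2 * j) = (\<Sum>i\<le>2 * j. (-1) ^ i * a i * a (2 * j - i))"
  shows "a j \<in> \<int>"
proof -
  define P where "P D \<longleftrightarrow> D > 0 \<and> (\<forall>j. of_nat D * a j \<in> \<int>)" for D :: nat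
  \<comment> \<open>\<open>D\<close> is the least common denominator of all \<open>a j\<close>; a
    prime divisor of \<open>D\<close> will contradict either minimality or the convolution
    identity.\<close>
  define D where "D = (LEAST D. P D)"
  have "\<exists>D. P D" using common_denominator[OF fin rat] by (auto simp: P_def)
  then have PD: "P D" unfolding D_def by (rule LeastI_ex)
  have "D = 1"
  proof (rule ccontr)
    assume "D \<noteq> 1"
    then obtain p where p: "prime p" "p dvd D" using prime_factor_nat by blast
    obtain D' where D': "D = p * D'" using p by auto
    have "D' > 0" "D' < D" using PD D' prime_gt_1_nat[OF p(1)] by (auto simp: P_def)
    have "\<forall>j. \<exists>b. of_nat D * a j = of_int b" using PD by (auto simp: P_def elim: Ints_cases)
    then obtain b :: "nat \<Rightarrow> int" where b: "\<And>j. of_nat D * a j = of_int (b j)" by metis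
    \<comment> \<open>If \<open>p\<close> divided every numerator, \<open>D' = D / p\<close> would
      be a smaller common denominator.\<close>
    have "\<exists>j. \<not> int p dvd b j"
    proof (rule ccontr)
      assume "\<not> ?thesis"
      then have dv: "int p dvd b j" for j by blast
      have "of_nat D' * a j \<in> \<int>" for j
      proof -
        obtain e where "b j = int p * e" using dv[of j] by (elim dvdE)
        then have "of_nat p * (of_nat D' * a j) = of_nat p * of_int e"
          using b[of j] D' by (simp add: mult.assoc)
        moreover have "of_nat p \<noteq> (0::complex)" using p(1) by auto
        ultimately show ?thesis by simp
      qed
      then have "P D'" using \<open>D' > 0\<close> by (simp add: P_def)
      then have "D \<le> D'" unfolding D_def by (rule Least_le)
      with \<open>D' < D\<close> show False by simp
    qed
    \<comment> \<open>As in Gauss's lemma, \<open>n\<close> is the first index whose numerator is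
      prime to \<open>p\<close>. In the identity for \<open>a (2 * n)\<close>, multiplied by
      \<open>D\<close> squared, the left side and all terms except \<open>i = n\<close> are
      divisible by \<open>p\<close>, so \<open>p\<close> must divide the square of
      \<open>b n\<close>.\<close>
    define n where "n = (LEAST j. \<not> int p dvd b j)"
    have n: "\<not> int p dvd b n" unfolding n_def by (rule LeastI_ex) fact
    have less_n: "int p dvd b i" if "i < n" for i
      using not_less_Least[of i "\<lambda>j. \<not> int p dvd b j"] that unfolding n_def by blast
    have "of_int (int D * b (2 * n)) = of_nat D * of_nat D * a (2 * n)"
      using b[of "2 * n"] by simp
    also have "\<dots> = (\<Sum>i\<le>2 * n. (-1) ^ i * (of_nat D * a i) * (of_nat D * a (2 * n - i)))"
      unfolding eq[of n] sum_distrib_left by (intro sum.cong) auto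
    also have "\<dots> = of_int (\<Sum>i\<le>2 * n. (-1) ^ i * b i * b (2 * n - i))"
      by (simp add: b)
    finally have "int D * b (2 * n) = (\<Sum>i\<le>2 * n. (-1) ^ i * b i * b (2 * n - i))"
      using of_int_eq_iff by blast
    also have "\<dots> = (-1) ^ n * b n * b n + (\<Sum>i\<in>{..2 * n} - {n}. (-1) ^ i * b i * b (2 * n - i))"
      by (subst sum.remove[of _ n]) (auto simp: mult_2)
    finally have "(-1) ^ n * (b n * b n) =
        int D * b (2 * n) - (\<Sum>i\<in>{..2 * n} - {n}. (-1) ^ i * b i * b (2 * n - i))"
      by (simp add: mult.assoc)
    moreover have "int p dvd (\<Sum>i\<in>{..2 * n} - {n}. (-1) ^ i * b i * b (2 * n - i))"
    proof (rule dvd_sum)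
      fix i assume "i \<in> {..2 * n} - {n}"
      then have "i < n \<or> 2 * n - i < n" by auto
      then show "int p dvd (-1) ^ i * b i * b (2 * n - i)" using less_n by auto
    qed
    moreover have "int p dvd int D * b (2 * n)" using p(2) by simp
    ultimately have "int p dvd (-1) ^ n * (b n * b n)" by simp
    then have "int p dvd b n * b n" by (cases "even n") auto
    then show False using n p(1) prime_dvd_mult_iff[of "int p"] by auto
  qed
  with PD show ?thesis by (auto simp: P_def)
qed

section \<open>Levels in a rooted tree\<close>

text \<open>Take \<open>d\<close> to be the distance from \<open>r\<close>. Every other vertex has a
  neighbour one level lower, its parent, and the edges to parents are pairwise distinct. There are
  \<open>card V - 1\<close> of them, so they exhaust the edges: every edge joins a vertex to its
  only parent.\<close>

lemma tree_levels:
  assumes fin: "finite V" and r: "r \<in> V"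
    and E: "\<And>x y. E x y \<Longrightarrow> x \<in> V \<and> y \<in> V \<and> E y x"
    and conn: "\<And>x. x \<in> V \<Longrightarrow> E\<^sup>*\<^sup>* r x"
    and card: "card V = Suc (card (edges E))"
  obtains d :: "'a \<Rightarrow> nat" where "d r = 0"
    "\<And>x y. E x y \<Longrightarrow> d x = Suc (d y) \<or> d y = Suc (d x)"
    "\<And>x y z. E x y \<Longrightarrow> E x z \<Longrightarrow> d x = Suc (d y) \<Longrightarrow> d x = Suc (d z) \<Longrightarrow> y = z"
proof -
  define d where "d x = (LEAST n. (E ^^ n) r x)" for x
  have reach: "(E ^^ d x) r x" if "x \<in> V" for x
    unfolding d_def by (rule LeastI_ex) (use conn[OF that] rtranclp_imp_relpowp in metis)
  have d_le: "d x \<le> n" if "(E ^^ n) r x" for x n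
    unfolding d_def using that by (rule Least_le)
  have d_r: "d r = 0" using d_le[of 0 r] by simp
  have "\<exists>y. E x y \<and> d x = Suc (d y)" if x: "x \<in> V - {r}" for x
  proof -
    have "d x \<noteq> 0" using reach[of x] x by (auto intro: ccontr)
    then obtain m where m: "d x = Suc m" by (cases "d x") auto
    then obtain y where y: "(E ^^ m) r y" "E y x"
      using reach[of x] x by (metis DiffD1 relpowp_Suc_E)
    have "(E ^^ Suc (d y)) r x" using reach[of y] E y(2) by (meson relpowp_Suc_I)
    then have "d x \<le> Suc (d y)" by (rule d_le)
    with m d_le[OF y(1)] E[OF y(2)] show ?thesis by auto
  qed
  then obtain par where par: "\<And>x. x \<in> V - {r} \<Longrightarrow> E x (par x) \<and> d x = Suc (d (par x))"
    by metis
  have inj: "inj_on (\<lambda>x. {x, par x}) (V - {r})"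
  proof (rule inj_onI)
    fix x y assume "x \<in> V - {r}" "y \<in> V - {r}" "{x, par x} = {y, par y}"
    then show "x = y" using par[of x] par[of y] by (auto simp: doubleton_eq_iff)
  qed
  have sub: "(\<lambda>x. {x, par x}) ` (V - {r}) \<subseteq> edges E"
    using par by (force simp: edges_def)
  have "edges E \<subseteq> Pow V" using E by (force simp: edges_def)
  then have "finite (edges E)" using fin by (meson finite_Pow_iff finite_subset)
  then have all: "(\<lambda>x. {x, par x}) ` (V - {r}) = edges E"
    using sub card r fin by (intro card_subset_eq) (simp_all add: card_image[OF inj])
  have edge: "(y = par x \<and> d x = Suc (d y)) \<or> (x = par y \<and> d y = Suc (d x))" if "E x y" for x y
  proof -
    have "{x, y} \<in> edges E" using that by (auto simp: edges_def)
    then obtain z where "z \<in> V - {r}" "{x, y} = {z, par z}" unfolding all[symmetric] by auto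
    then show ?thesis using par[of z] by (auto simp: doubleton_eq_iff)
  qed
  show thesis
  proof (rule that[of d])
    show "y = z" if "E x y" "E x z" "d x = Suc (d y)" "d x = Suc (d z)" for x y z
      using edge[OF that(1)] edge[OF that(2)] that(3,4) by auto
  qed (use d_r edge in blast)+
qed

section \<open>The Grover walk as a map on amplitudes\<close>

text \<open>One application of \<open>U\<close>, with \<open>x a b\<close> the amplitude on the arc
  \<open>(a, b)\<close>: the sum collects what arrives at \<open>a\<close>, and the subtracted term
  is the -1 in the entry of \<open>U\<close> for reversal. Amplitudes are functions on all pairs,
  but only their values at arcs are meaningful.\<close>

definition step :: "('a \<Rightarrow> 'a \<Rightarrow> bool) \<Rightarrow> ('a \<Rightarrow> 'a \<Rightarrow> complex) \<Rightarrow> 'a \<Rightarrow> 'a \<Rightarrow> complex" where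
  "step E x a b = 2 / of_nat (deg E a) * (\<Sum>y | E a y. x y a) - x b a"

fun evolve :: "('a \<Rightarrow> 'a \<Rightarrow> bool) \<Rightarrow> ('a \<Rightarrow> 'a \<Rightarrow> complex) \<Rightarrow> nat \<Rightarrow> 'a \<Rightarrow> 'a \<Rightarrow> complex" where
  "evolve E x 0 = x"
| "evolve E x (Suc n) = step E (evolve E x n)"

definition ind :: "'a \<Rightarrow> 'a \<Rightarrow> 'a \<Rightarrow> 'a \<Rightarrow> complex" where
  "ind p q a b = (if a = p \<and> b = q then 1 else 0)"

lemma ind_swap: "ind p q a b = ind q p b a"
  by (auto simp: ind_def)

lemma step_cong:
  assumes "\<And>a b. E a b \<Longrightarrow> E b a" "\<And>a b. E a b \<Longrightarrow> x a b = y a b" "E a b"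
  shows "step E x a b = step E y a b"
  using assms by (auto simp: step_def intro!: sum.cong arg_cong2[where f = "(*)"])

lemma step_add: "step E (\<lambda>a b. x a b + y a b) a b = step E x a b + step E y a b"
  by (simp add: step_def sum.distrib algebra_simps)

lemma step_scale: "step E (\<lambda>a b. s * x a b) a b = s * step E x a b"
  by (simp add: step_def sum_distrib_left[symmetric] algebra_simps)

text \<open>The new amplitude on \<open>(a, b)\<close> reads only arcs that end at \<open>a\<close>,
  so a weight at the terminal vertex turns into a weight at the initial vertex.\<close>

lemma step_scale_target: "step E (\<lambda>y z. x y z * s z) a b = step E x a b * s a"
  by (simp add: step_def sum_distrib_right left_diff_distrib mult.assoc)

lemma step_sum: "step E (\<lambda>a b. \<Sum>i\<in>I. x i a b) a b = (\<Sum>i\<in>I. step E (x i) a b)"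
  by (simp add: step_def sum_subtractf sum_distrib_left sum.swap[of _ I])

text \<open>At degree two the factor \<open>2 / deg\<close> is 1, so nothing is reflected and the
  amplitude passes straight through.\<close>

lemma step_deg2:
  assumes "{y. E a y} = {b', b}" "b' \<noteq> b"
  shows "step E x a b = x b' a"
  using assms by (simp add: step_def deg_def)

text \<open>The guard \<open>E p q\<close> matters: at a pair \<open>(a, q)\<close> with
  \<open>q\<close> not adjacent to \<open>a\<close>, \<open>step\<close> would return 1.\<close>

lemma step_ind_deg2:
  assumes nb: "{y. E a y} = {b', b}" "b' \<noteq> b" and "E p q"
  shows "step E (ind b' a) p q = ind a b p q"
proof (cases "p = a")
  case True
  have "q = b' \<or> q = b" using assms True by auto
  then show ?thesis using nb True by (auto simp: step_def deg_def ind_def)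
next
  case False
  then show ?thesis by (auto simp: step_def ind_def)
qed

lemma finite_arcs:
  assumes "simple_graph V E"
  shows "finite (arcs E)"
proof (rule finite_subset)
  show "arcs E \<subseteq> V \<times> V" using assms by (auto simp: simple_graph_def arcs_def)
  show "finite (V \<times> V)" using assms by (simp add: simple_graph_def)
qed

text \<open>The entry of \<open>U\<close> at \<open>((a, b), g)\<close> is
  \<open>2 / deg E a\<close> if \<open>g\<close> ends at \<open>a\<close>, minus 1 if
  \<open>g = (b, a)\<close>; the two parts are summed separately.\<close>

lemma grover_sum:
  assumes G: "simple_graph V E" and e: "E a b"
  shows "(\<Sum>g\<in>arcs E. grover E (a, b) g * x (fst g) (snd g)) = step E x a b"
proof -
  have sym: "E y z \<longleftrightarrow> E z y" for y z using G by (auto simp: simple_graph_def)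
  have fin: "finite (arcs E)" using G by (rule finite_arcs)
  have "grover E (a, b) g * x (fst g) (snd g) =
      (if snd g = a then 2 / of_nat (deg E a) * x (fst g) (snd g) else 0) -
      (if g = (b, a) then x (fst g) (snd g) else 0)" for g
    by (cases g) (auto simp: grover_def algebra_simps)
  then have "(\<Sum>g\<in>arcs E. grover E (a, b) g * x (fst g) (snd g)) =
      (\<Sum>g\<in>arcs E. if snd g = a then 2 / of_nat (deg E a) * x (fst g) (snd g) else 0) -
      (\<Sum>g\<in>arcs E. if g = (b, a) then x (fst g) (snd g) else 0)"
    by (simp add: sum_subtractf)
  also have "(\<Sum>g\<in>arcs E. if g = (b, a) then x (fst g) (snd g) else 0) = x b a"
    using fin e by (simp add: sum.delta arcs_def sym)
  also have "(\<Sum>g\<in>arcs E. if snd g = a then 2 / of_nat (deg E a) * x (fst g) (snd g) else 0) =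
      (\<Sum>g\<in>{g \<in> arcs E. snd g = a}. 2 / of_nat (deg E a) * x (fst g) (snd g))"
    using fin by (rule sum.inter_filter[symmetric])
  also have "{g \<in> arcs E. snd g = a} = (\<lambda>y. (y, a)) ` {y. E a y}"
    by (auto simp: arcs_def sym)
  also have "(\<Sum>g\<in>\<dots>. 2 / of_nat (deg E a) * x (fst g) (snd g)) =
      2 / of_nat (deg E a) * (\<Sum>y | E a y. x y a)"
    by (subst sum.reindex) (auto simp: inj_on_def sum_distrib_left)
  finally show ?thesis by (simp add: step_def)
qed

lemma evolve_eq_mat_pow:
  assumes G: "simple_graph V E" and "E a b"
  shows "evolve E x n a b = (\<Sum>f\<in>arcs E. mat_pow (arcs E) (grover E) n (a, b) f * x (fst f) (snd f))"
  using assms(2)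
proof (induction n arbitrary: a b)
  case 0
  have "finite (arcs E)" using G by (rule finite_arcs)
  moreover have "mat_id (a, b) f * x (fst f) (snd f) = (if (a, b) = f then x a b else 0)" for f
    by (auto simp: mat_id_def)
  ultimately show ?case using 0 by (simp add: arcs_def)
next
  case (Suc n)
  have sym: "\<And>y z. E y z \<Longrightarrow> E z y" using G by (auto simp: simple_graph_def)
  let ?M = "mat_pow (arcs E) (grover E) n"
  have "evolve E x (Suc n) a b =
      (\<Sum>g\<in>arcs E. grover E (a, b) g * evolve E x n (fst g) (snd g))"
    using grover_sum[OF G Suc.prems] by simp
  also have "\<dots> = (\<Sum>g\<in>arcs E. \<Sum>f\<in>arcs E. grover E (a, b) g * ?M g f * x (fst f) (snd f))"
    by (intro sum.cong refl)
      (auto simp: arcs_def Suc.IH sum_distrib_left mult.assoc)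
  also have "\<dots> = (\<Sum>f\<in>arcs E. \<Sum>g\<in>arcs E. grover E (a, b) g * ?M g f * x (fst f) (snd f))"
    by (rule sum.swap)
  finally show ?case by (simp add: mat_mult_def sum_distrib_right)
qed

lemma evolve_periodic:
  assumes G: "simple_graph V E" and m: "grover_power_id E m" and e: "E a b"
  shows "evolve E x (m + n) a b = evolve E x n a b"
  using e
proof (induction n arbitrary: a b)
  case 0
  have fin: "finite (arcs E)" using G by (rule finite_arcs)
  have "evolve E x m a b = (\<Sum>f\<in>arcs E. mat_id (a, b) f * x (fst f) (snd f))"
    unfolding evolve_eq_mat_pow[OF G 0] using m 0
    by (intro sum.cong) (auto simp: grover_power_id_def arcs_def)
  also have "\<dots> = (\<Sum>f\<in>arcs E. if (a, b) = f then x a b else 0)"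
    by (intro sum.cong) (auto simp: mat_id_def)
  finally show ?case using 0 fin by (simp add: arcs_def)
next
  case (Suc n)
  have "\<And>y z. E y z \<Longrightarrow> E z y" using G by (auto simp: simple_graph_def)
  then have "step E (evolve E x (m + n)) a b = step E (evolve E x n) a b"
    using Suc by (intro step_cong) auto
  then show ?case by simp
qed

section \<open>Integrality of return amplitudes and its arithmetic consequence\<close>

lemma evolve_Rats:
  assumes "\<And>a b. x a b \<in> \<rat>"
  shows "evolve E x n a b \<in> \<rat>"
proof (induction n arbitrary: a b)
  case (Suc n)
  have "(\<Sum>y | E a y. evolve E x n y a) \<in> \<rat>" by (intro Rats_sum Suc)
  with Suc show ?case by (auto simp: step_def intro!: Rats_diff Rats_mult Rats_divide)
qed (simp add: assms)

lemma finite_range_periodic: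
  fixes a :: "nat \<Rightarrow> 'b"
  assumes "m > 0" "\<And>n. a (m + n) = a n"
  shows "finite (range a)"
proof -
  have "a n \<in> a ` {..<m}" for n
  proof (induction n rule: less_induct)
    case (less n)
    show ?case
    proof (cases "n < m")
      case False
      then have "a (n - m) \<in> a ` {..<m}" using assms(1) by (intro less) auto
      then show ?thesis using False assms(2)[of "n - m"] by simp
    qed simp
  qed
  then have "range a \<subseteq> a ` {..<m}" by auto
  then show ?thesis by (rule finite_subset) simp
qed

text \<open>Conjugating the evolution by the sign of the level of the initial vertex turns \<open>U\<close> into
  \<open>-U\<close>, except on the two arcs of the edge \<open>pq\<close>; expanding in this perturbation gives the
  identity.\<close>

lemma evolve_sign:
  fixes d :: "'a \<Rightarrow> nat"
  assumes sym: "\<And>x y. E x y \<Longrightarrow> E y x" and pq: "E p q" "p \<noteq> q"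
    and lev: "\<And>x y. E x y \<Longrightarrow> {x, y} \<noteq> {p, q} \<Longrightarrow> odd (d x + d y)"
    and lev_pq: "even (d p + d q)"
    and X: "X = evolve E (\<lambda>a b. ind p q a b + ind q p a b)"
    and eq: "\<And>j. X j p q = X j q p"
    and ab: "E a b"
  shows "X j a b * (1 - (-1) ^ (j + d p + d a)) =
    2 * (\<Sum>i<j. (-1) ^ i * X i p q * X (j - i) a b)"
proof -
  have X0: "X 0 y z = (if (y = p \<and> z = q) \<or> (y = q \<and> z = p) then 1 else 0)" for y z
    using pq(2) by (auto simp: X ind_def)
  show ?thesis using ab
proof (induction j arbitrary: a b)
  case 0
  then show ?case using lev_pq by (auto simp: X0)
next
  case (Suc j)
  \<comment> \<open>Across an edge other than \<open>pq\<close> the level sign flips, so the sign at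
    \<open>y\<close> is minus the sign at \<open>z\<close>. On the two arcs of \<open>pq\<close>
    both signs equal \<open>(-1) ^ j\<close>; the discrepancy is a multiple of the initial state
    \<open>X 0\<close>.\<close>
  have *: "X j y z * (1 - (-1) ^ (j + d p + d y)) =
      X j y z * (1 + (-1) ^ (j + d p + d z)) +
      (- 2 * (-1) ^ j * X j p q) * X 0 y z" if "E y z" for y z
  proof (cases "{y, z} = {p, q}")
    case True
    then consider "y = p" "z = q" | "y = q" "z = p" by (auto simp: doubleton_eq_iff)
    then have 1: "X 0 y z = 1" "X j y z = X j p q" "even (d p + d y)" "even (d p + d z)"
      using pq(2) lev_pq eq[of j] by (cases; force simp: X0)+
    have "(-1) ^ (j + d p + d y) = ((-1) ^ j :: complex)"
      "(-1) ^ (j + d p + d z) = ((-1) ^ j :: complex)"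
      unfolding add.assoc power_add[of _ j] using 1(3,4) by simp_all
    then show ?thesis using 1(1,2) by (simp add: algebra_simps)
  next
    case False
    then have "X 0 y z = 0" by (auto simp: X0)
    moreover have "(-1) ^ (d y) = - ((-1) ^ (d z) :: complex)"
      using lev[OF that False] by (cases "even (d y)") (auto simp: uminus_power_if)
    ultimately show ?thesis by (simp add: power_add)
  qed
  \<comment> \<open>Applying \<open>step\<close> moves the sign from \<open>z\<close> to
    \<open>a\<close> and turns the correction by \<open>X 0\<close> into \<open>X 1\<close>, which
    is the new summand \<open>i = j\<close>. Since \<open>1 + e = 1 - (- e)\<close>, the sign is
    then the one for time \<open>Suc j\<close>.\<close>
  have "X (Suc j) a b * (1 + (-1) ^ (j + d p + d a)) + (- 2 * (-1) ^ j * X j p q) * X 1 a b =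
     step E (\<lambda>y z. X j y z * (1 + (-1) ^ (j + d p + d z)) + (- 2 * (-1) ^ j * X j p q) * X 0 y z) a b"
    unfolding step_add step_scale step_scale_target by (simp add: X)
  also have "\<dots> = step E (\<lambda>y z. 2 * (\<Sum>i<j. ((-1) ^ i * X i p q) * X (j - i) y z)) a b"
  proof (rule step_cong)
    show "E z y" if "E y z" for y z using that by (rule sym)
    show "X j y z * (1 + (-1) ^ (j + d p + d z)) + (- 2 * (-1) ^ j * X j p q) * X 0 y z =
        2 * (\<Sum>i<j. ((-1) ^ i * X i p q) * X (j - i) y z)" if "E y z" for y z
      using *[OF that] Suc.IH[OF that] by simp
  qed (fact Suc.prems)
  also have "\<dots> = 2 * (\<Sum>i<j. ((-1) ^ i * X i p q) * X (Suc j - i) a b)"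
    unfolding step_scale step_sum by (simp add: X Suc_diff_le)
  finally have "X (Suc j) a b * (1 + (-1) ^ (j + d p + d a)) + (- 2 * (-1) ^ j * X j p q) * X 1 a b =
    2 * (\<Sum>i<j. ((-1) ^ i * X i p q) * X (Suc j - i) a b)" .
  moreover have "A * (1 + e) + (- 2 * r * x) * y = 2 * S \<Longrightarrow> A * (1 - (- e)) = 2 * (S + r * x * y)"
    for A e r x y S :: complex
    by (simp add: algebra_simps)
  ultimately have "X (Suc j) a b * (1 - (- ((-1) ^ (j + d p + d a)))) =
    2 * ((\<Sum>i<j. ((-1) ^ i * X i p q) * X (Suc j - i) a b) + (-1) ^ j * X j p q * X 1 a b)"
    by blast
  then show ?case by simp
qed
qed

text \<open>Periodicity leaves only finitely many return amplitudes, all rational, and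
  \<open>evolve_sign\<close> on the arc \<open>(p, q)\<close> supplies the identity for the even
  part.\<close>

lemma evolve_return_integral:
  fixes d :: "'a \<Rightarrow> nat"
  assumes G: "simple_graph V E" and per: "grover_periodic E" and pq: "E p q"
    and lev: "\<And>x y. E x y \<Longrightarrow> {x, y} \<noteq> {p, q} \<Longrightarrow> odd (d x + d y)"
    and lev_pq: "even (d p + d q)"
    and X: "X = evolve E (\<lambda>a b. ind p q a b + ind q p a b)"
    and eq: "\<And>j. X j p q = X j q p"
  shows "X j p q \<in> \<int>"
proof (rule integral_of_even_part_eq)
  obtain m where m: "m \<ge> 1" "grover_power_id E m" using per by (auto simp: grover_periodic_def)
  then show "finite (range (\<lambda>j. X j p q))"
    using evolve_periodic[OF G m(2) pq] by (intro finite_range_periodic[of m]) (auto simp: X)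
  show "range (\<lambda>j. X j p q) \<subseteq> \<rat>" unfolding X by (auto intro!: evolve_Rats simp: ind_def)
  have sym: "\<And>x y. E x y \<Longrightarrow> E y x" and "p \<noteq> q" using G pq by (auto simp: simple_graph_def)
  show "X (2 * j) p q = (\<Sum>i\<le>2 * j. (-1) ^ i * X i p q * X (2 * j - i) p q)" for j
  proof -
    have X0: "X 0 p q = 1" using \<open>p \<noteq> q\<close> by (simp add: X ind_def)
    \<comment> \<open>At initial vertex \<open>p\<close> and even time the sign is 1, so the left
      side vanishes. The sum over \<open>i < 2 * j\<close> is therefore 0, and the missing term
      \<open>i = 2 * j\<close> is \<open>X (2 * j) p q\<close> because
      \<open>X 0 p q = 1\<close>.\<close>
    have "X (2 * j) p q * (1 - (-1) ^ (2 * j + d p + d p)) =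
        2 * (\<Sum>i<2 * j. (-1) ^ i * X i p q * X (2 * j - i) p q)"
      by (rule evolve_sign[where E = E and q = q])
        (fact sym pq \<open>p \<noteq> q\<close> lev lev_pq X eq)+
    moreover have "(-1) ^ (2 * j + d p + d p) = (1 :: complex)" by (simp add: add.assoc flip: mult_2)
    ultimately have "(\<Sum>i<2 * j. (-1) ^ i * X i p q * X (2 * j - i) p q) = 0" by simp
    then show ?thesis
      unfolding lessThan_Suc_atMost[symmetric] sum.lessThan_Suc by (simp add: X0)
  qed
qed

text \<open>Clearing denominators gives \<open>a + b = z * a * b\<close>, so \<open>a\<close> and
  \<open>b\<close> divide each other; then \<open>a = b\<close> and
  \<open>z * a = 2\<close>.\<close>

lemma unit_fractions_sum_integral:
  assumes "a > 0" "b > 0" "1 / of_nat a + 1 / of_nat b \<in> (\<int> :: complex set)"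
  shows "(a = 1 \<and> b = 1) \<or> (a = 2 \<and> b = 2)"
proof -
  obtain z where z: "1 / of_nat a + 1 / of_nat b = (of_int z :: complex)"
    using assms(3) by (auto elim: Ints_cases)
  then have "of_int (int a + int b) = (of_int (z * int a * int b) :: complex)"
    using assms(1,2) by (simp add: field_simps)
  then have eq: "int a + int b = z * int a * int b" using of_int_eq_iff by blast
  have "int a dvd int a + int b" "int b dvd int a + int b" unfolding eq by auto
  then have "a dvd b" "b dvd a" by (simp_all add: dvd_add_right_iff dvd_add_left_iff)
  then have ab: "a = b" by (rule dvd_antisym)
  with eq assms have "2 = z * int a" by simp
  then have "int a dvd 2" by (metis dvd_triv_right)
  then have "a dvd 2" by (metis int_dvd_int_iff of_nat_numeral)
  then have "a \<le> 2" by (simp add: dvd_imp_le)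
  with ab assms show ?thesis by auto
qed

section \<open>Pulses along paths of degree-two vertices\<close>

lemma nbrs_deg2:
  assumes "deg E a = 2" "E a b'" "E a b" "b' \<noteq> b"
  shows "{y. E a y} = {b', b}"
proof -
  have "card {y. E a y} = 2" using assms by (simp add: deg_def)
  moreover from this have "finite {y. E a y}" by (metis card.infinite zero_neq_numeral)
  ultimately show ?thesis using assms by (intro card_subset_eq[symmetric]) auto
qed

text \<open>The \<open>n\<close> inner vertices \<open>P 1\<close>, ..., \<open>P n\<close> have
  degree two; the ends \<open>P 0\<close> and \<open>P (n + 1)\<close> are unrestricted. A pulse
  thus needs \<open>n\<close> steps from the first arc to the last.\<close>

definition deg2_path :: "('a \<Rightarrow> 'a \<Rightarrow> bool) \<Rightarrow> (nat \<Rightarrow> 'a) \<Rightarrow> nat \<Rightarrow> bool" where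
  "deg2_path E P n \<longleftrightarrow>
     (\<forall>i<n. {y. E (P (Suc i)) y} = {P i, P (Suc (Suc i))} \<and> P i \<noteq> P (Suc (Suc i)))"

text \<open>Iterates \<open>step_deg2\<close>. It follows a single arc and makes no assumption on
  the other amplitudes, so it still applies once the state has scattered.\<close>

lemma deg2_path_transport:
  assumes X: "\<And>n. X (Suc n) = step E (X n)" and "deg2_path E P n"
  shows "X (j + n) (P n) (P (Suc n)) = X j (P 0) (P 1)"
  using assms(2)
proof (induction n)
  case (Suc n)
  then have "X (j + n) (P n) (P (Suc n)) = X j (P 0) (P 1)" by (simp add: deg2_path_def)
  moreover have "step E (X (j + n)) (P (Suc n)) (P (Suc (Suc n))) = X (j + n) (P n) (P (Suc n))"
    using Suc.prems by (intro step_deg2) (auto simp: deg2_path_def)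
  ultimately show ?case by (simp add: X)
qed simp

text \<open>Here the whole state is tracked: by linearity the two pulses travel independently and
  every other arc stays at 0.\<close>

lemma deg2_path_pulses:
  assumes sym: "\<And>a b. E a b \<Longrightarrow> E b a" and X: "\<And>n. X (Suc n) = step E (X n)"
    and start: "\<And>a b. E a b \<Longrightarrow> X j a b = ind (P 0) (P 1) a b + ind (Q 0) (Q 1) a b"
    and "deg2_path E P n" "deg2_path E Q n" "E a b"
  shows "X (j + n) a b = ind (P n) (P (Suc n)) a b + ind (Q n) (Q (Suc n)) a b"
  using assms(4-6)
proof (induction n arbitrary: a b)
  case 0
  then show ?case using start by simp
next
  case (Suc n)
  then have "deg2_path E P n" "deg2_path E Q n" by (auto simp: deg2_path_def)
  with Suc.IH have "step E (X (j + n)) a b =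
      step E (\<lambda>a b. ind (P n) (P (Suc n)) a b + ind (Q n) (Q (Suc n)) a b) a b"
    using Suc.prems(3) sym by (intro step_cong) auto
  also have "\<dots> = ind (P (Suc n)) (P (Suc (Suc n))) a b + ind (Q (Suc n)) (Q (Suc (Suc n))) a b"
    unfolding step_add using Suc.prems
    by (intro arg_cong2[where f = "(+)"] step_ind_deg2) (auto simp: deg2_path_def)
  finally show ?case by (simp add: X)
qed

section \<open>Levels of the unicycle graph with one cycle edge removed\<close>

text \<open>Removing one cycle edge keeps the graph connected, as the rest of the cycle bypasses it,
  and leaves \<open>card V - 1\<close> edges, so \<open>tree_levels\<close> applies to the remaining
  tree \<open>F\<close>.\<close>

lemma odd_unicycle_levels:
  assumes G: "odd_unicycle V E" and inj: "inj_on C {..<k}" and Ck: "C k = C 0"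
    and edge: "\<And>i. i < k \<Longrightarrow> E (C i) (C (Suc i))" and h: "0 < h" "Suc h < k"
  obtains d :: "'a \<Rightarrow> nat" where "d (C 0) = 0"
    "\<And>x y. E x y \<Longrightarrow> {x, y} \<noteq> {C h, C (Suc h)} \<Longrightarrow> d x = Suc (d y) \<or> d y = Suc (d x)"
    "\<And>x y z. E x y \<Longrightarrow> E x z \<Longrightarrow> {x, y} \<noteq> {C h, C (Suc h)} \<Longrightarrow> {x, z} \<noteq> {C h, C (Suc h)} \<Longrightarrow>
      d x = Suc (d y) \<Longrightarrow> d x = Suc (d z) \<Longrightarrow> y = z"
    "even (d (C h) + d (C (Suc h)))"
proof -
  define F where "F x y \<longleftrightarrow> E x y \<and> {x, y} \<noteq> {C h, C (Suc h)}" for x y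
  have simple: "simple_graph V E" and conn: "connected_graph V E"
    and card: "card V = card (edges E)" and nbip: "\<not> bipartite V E"
    using G by (auto simp: odd_unicycle_def)
  have E: "x \<in> V \<and> y \<in> V \<and> E y x" if "E x y" for x y
    using simple that by (auto simp: simple_graph_def)
  have fin: "finite V" using simple by (simp add: simple_graph_def)
  have F: "x \<in> V \<and> y \<in> V \<and> F y x" if "F x y" for x y
    using that E by (auto simp: F_def insert_commute)
  have C_eq: "C i = C j \<longleftrightarrow> i = j" if "i < k" "j < k" for i j
    using inj that by (auto simp: inj_on_def)
  have up: "F\<^sup>*\<^sup>* (C 0) (C i)" if "i \<le> h" for i
    using that
  proof (induction i)
    case (Suc i)
    have "F (C i) (C (Suc i))"
      using Suc.prems h edge[of i] by (auto simp: F_def doubleton_eq_iff C_eq)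
    then show ?case using Suc by (meson Suc_leD rtranclp.rtrancl_into_rtrancl)
  qed simp
  have down: "F\<^sup>*\<^sup>* (C (Suc h)) (C i)" if "Suc h \<le> i" "i \<le> k" for i
    using that
  proof (induction i rule: dec_induct)
    case (step i)
    have "F (C i) (C (Suc i))"
    proof (cases "Suc i = k")
      case True
      then show ?thesis using step h edge[of i] by (auto simp: F_def doubleton_eq_iff C_eq Ck)
    next
      case False
      then show ?thesis using step h edge[of i] by (auto simp: F_def doubleton_eq_iff C_eq)
    qed
    then show ?case using step by (meson Suc_leD rtranclp.rtrancl_into_rtrancl)
  qed simp
  have sF: "symp F" using F by (blast intro: sympI)
  have "F\<^sup>*\<^sup>* (C (Suc h)) (C h)"
    using down[of k] up[of h] h Ck by (metis less_imp_le_nat order_refl rtranclp_trans)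
  then have path: "F\<^sup>*\<^sup>* (C (Suc h)) (C h)" "F\<^sup>*\<^sup>* (C h) (C (Suc h))"
    using symp_rtranclp[OF sF] by (auto dest: sympD)
  have EF: "F\<^sup>*\<^sup>* x y" if "E\<^sup>*\<^sup>* x y" for x y
    using that
  proof (induction rule: rtranclp_induct)
    case (step y z)
    have "F\<^sup>*\<^sup>* y z" using step(2) path by (cases "F y z") (auto simp: F_def doubleton_eq_iff)
    with step show ?case by (meson rtranclp_trans)
  qed simp
  have eh: "E (C h) (C (Suc h))" using edge[of h] h by simp
  have "edges F = edges E - {{C h, C (Suc h)}}" by (force simp: edges_def F_def)
  moreover have "{C h, C (Suc h)} \<in> edges E" using eh by (auto simp: edges_def)
  moreover have "edges E \<subseteq> Pow V" using E by (force simp: edges_def)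
  then have "finite (edges E)" using fin by (meson finite_Pow_iff finite_subset)
  ultimately have cardF: "card V = Suc (card (edges F))"
    using card by (metis card_Suc_Diff1)
  have CV: "C 0 \<in> V" using edge[of 0] E[of "C 0"] h by simp
  then have connF: "F\<^sup>*\<^sup>* (C 0) x" if "x \<in> V" for x
    using conn that by (intro EF) (simp add: connected_graph_def)
  obtain d where d: "d (C 0) = 0"
    "\<And>x y. F x y \<Longrightarrow> d x = Suc (d y) \<or> d y = Suc (d x)"
    "\<And>x y z. F x y \<Longrightarrow> F x z \<Longrightarrow> d x = Suc (d y) \<Longrightarrow> d x = Suc (d z) \<Longrightarrow> y = z"
  proof (rule tree_levels[of V "C 0" F])
    fix d
    assume "d (C 0) = 0" "\<And>x y. F x y \<Longrightarrow> d x = Suc (d y) \<or> d y = Suc (d x)"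
      "\<And>x y z. F x y \<Longrightarrow> F x z \<Longrightarrow> d x = Suc (d y) \<Longrightarrow> d x = Suc (d z) \<Longrightarrow> y = z"
    then show thesis by (rule that)
  qed (auto simp: fin CV connF cardF dest: F)
  \<comment> \<open>With ends of opposite parity, the removed edge would also respect the parity
    classes of \<open>d\<close>, and these would make the whole graph bipartite.\<close>
  have "even (d (C h) + d (C (Suc h)))"
  proof (rule ccontr)
    assume odd: "\<not> ?thesis"
    have "odd (d x + d y)" if "E x y" for x y
      using that odd d(2)[of x y] by (cases "F x y") (auto simp: F_def doubleton_eq_iff)
    then have "bipartite V E" unfolding bipartite_def
      by (intro exI[of _ "{x. even (d x)}"]) auto
    with nbip show False ..
  qed
  then show thesis by (intro that[of d] d[unfolded F_def] conjI)
qed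

text \<open>\<open>S\<close> stands for the cycle, which can be left or entered only at
  \<open>v 0\<close>. The next vertex differs from the unique lower neighbour, so each step goes up
  one level; levels above 0 exclude \<open>v 0\<close>, hence the branch never returns to
  \<open>S\<close>.\<close>

lemma branch_levels:
  fixes d :: "'a \<Rightarrow> nat"
  assumes sym: "\<And>x y. E x y \<Longrightarrow> E y x" and d0: "d (v 0) = 0"
    and lev: "\<And>x y. E x y \<Longrightarrow> {x, y} \<noteq> {p, q} \<Longrightarrow> d x = Suc (d y) \<or> d y = Suc (d x)"
    and uniq: "\<And>x y z. E x y \<Longrightarrow> E x z \<Longrightarrow> {x, y} \<noteq> {p, q} \<Longrightarrow> {x, z} \<noteq> {p, q} \<Longrightarrow>
      d x = Suc (d y) \<Longrightarrow> d x = Suc (d z) \<Longrightarrow> y = z"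
    and S: "p \<in> S" "q \<in> S" "\<And>x y. x \<in> S \<Longrightarrow> x \<noteq> v 0 \<Longrightarrow> E x y \<Longrightarrow> y \<in> S"
    and v1: "E (v 0) (v 1)" "v 1 \<notin> S"
    and step: "\<And>j. Suc j < n \<Longrightarrow> E (v (Suc j)) (v (Suc (Suc j))) \<and> v (Suc (Suc j)) \<noteq> v j"
  shows "j < n \<Longrightarrow> E (v j) (v (Suc j)) \<and> d (v (Suc j)) = Suc j \<and> d (v j) = j \<and> v (Suc j) \<notin> S"
proof (induction j)
  case 0
  have "{v 0, v 1} \<noteq> {p, q}" using S(1,2) v1(2) by (auto simp: doubleton_eq_iff)
  then show ?case using lev[of "v 0" "v 1"] v1 d0 by auto
next
  case (Suc j)
  then have IH: "E (v j) (v (Suc j))" "d (v (Suc j)) = Suc j" "d (v j) = j" "v (Suc j) \<notin> S"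
    by auto
  have e: "E (v (Suc j)) (v (Suc (Suc j)))" "v (Suc (Suc j)) \<noteq> v j" using step Suc.prems by auto
  have ne: "{v (Suc j), y} \<noteq> {p, q}" for y using IH(4) S(1,2) by (auto simp: doubleton_eq_iff)
  have "d (v (Suc (Suc j))) = Suc (Suc j)"
    using lev[OF e(1) ne] uniq[OF e(1) sym[OF IH(1)] ne ne] IH e(2) by auto
  moreover from this have "v (Suc (Suc j)) \<noteq> v 0" using d0 by (metis nat.simps(3))
  then have "v (Suc (Suc j)) \<notin> S"
    using S(3)[of "v (Suc (Suc j))" "v (Suc j)"] sym[OF e(1)] IH(4) by auto
  ultimately show ?case using e IH by auto
qed

section \<open>The pulse in the given graph\<close>

theorem theorem3p8:
  fixes V :: "'a set" and E :: "'a \<Rightarrow> 'a \<Rightarrow> bool"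
    and k t :: nat and c v w :: "nat \<Rightarrow> 'a"
  assumes G: "odd_unicycle V E"
    and per: "grover_periodic E" and odd_per: "odd (grover_period E)"
    and k: "k \<ge> 3" "odd k"
    and cyc_dist: "inj_on c {0..<k}"
    and cyc_edge: "\<forall>i<k. E (c i) (c (Suc i mod k))"
    and deg_u: "deg E (c 0) = 4"
    and deg_ui: "\<forall>i. 1 \<le> i \<and> i \<le> k - 1 \<longrightarrow> deg E (c i) = 2"
    and t: "t \<ge> 1"
    and v0: "v 0 = c 0" and w0: "w 0 = c 0"
    and v1: "E (c 0) (v 1)" "v 1 \<notin> c ` {0..<k}"
    and w1: "E (c 0) (w 1)" "w 1 \<notin> c ` {0..<k}"
    and vw: "v 1 \<noteq> w 1"
    and v_step: "\<forall>j. 2 \<le> j \<and> j \<le> t + 1 \<longrightarrow> E (v (j - 1)) (v j) \<and> v j \<noteq> v (j - 2)"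
    and w_step: "\<forall>j. 2 \<le> j \<and> j \<le> t + 1 \<longrightarrow> E (w (j - 1)) (w j) \<and> w j \<noteq> w (j - 2)"
    and deg_v: "\<forall>j. 1 \<le> j \<and> j \<le> t \<longrightarrow> deg E (v j) = 2"
    and deg_w: "\<forall>j. 1 \<le> j \<and> j \<le> t \<longrightarrow> deg E (w j) = 2"
  shows "(deg E (v (t + 1)) = 1 \<and> deg E (w (t + 1)) = 1) \<or>
         (deg E (v (t + 1)) = 2 \<and> deg E (w (t + 1)) = 2)"
proof -
  have simple: "simple_graph V E" using G by (simp add: odd_unicycle_def)
  have sym: "E y x" if "E x y" for x y using simple that by (simp add: simple_graph_def)
  have fin_nbrs: "finite {y. E x y}" for x
    using simple by (auto simp: simple_graph_def intro: finite_subset[of _ V])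
  obtain h where h: "k = Suc (2 * h)" using k(2) by (auto elim: oddE)
  have h0: "h > 0" using h k by simp
  \<comment> \<open>Cyclic indexing makes \<open>C k\<close> again the vertex \<open>u\<close>, so
    both directions around the cycle can be written as index paths ending at
    \<open>u\<close>.\<close>
  define C where "C i = c (i mod k)" for i
  define S where "S = c ` {0..<k}"
  have C_eq: "C i = C j \<longleftrightarrow> i = j" if "i < k" "j < k" for i j
    using cyc_dist that by (auto simp: C_def inj_on_def)
  have Ck: "C k = C 0" and C0: "C 0 = c 0" by (simp_all add: C_def)
  have C_edge: "E (C i) (C (Suc i))" if "i < k" for i
    using cyc_edge that by (simp add: C_def)
  have C_S: "C i \<in> S" for i using k by (auto simp: S_def C_def)
  have C_deg2: "{y. E (C (Suc i)) y} = {C i, C (Suc (Suc i))} \<and> C i \<noteq> C (Suc (Suc i))"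
    if "Suc i < k" for i
  proof -
    have ne: "C i \<noteq> C (Suc (Suc i))"
    proof (cases "Suc (Suc i) = k")
      case True
      then show ?thesis using that k C_eq[of i 0] by (auto simp: Ck)
    next
      case False
      then show ?thesis using that C_eq[of i "Suc (Suc i)"] by simp
    qed
    moreover have "deg E (C (Suc i)) = 2" using deg_ui that by (simp add: C_def)
    ultimately show ?thesis
      using nbrs_deg2[of E "C (Suc i)", OF _ sym[OF C_edge[of i]] C_edge[of "Suc i"]] that by simp
  qed
  have S_closed: "y \<in> S" if "x \<in> S" "x \<noteq> c 0" "E x y" for x y
  proof -
    obtain i where i: "i < k" "x = c i" using \<open>x \<in> S\<close> by (auto simp: S_def)
    with that obtain i' where "i = Suc i'" by (cases i) auto
    then have "y = C i' \<or> y = C (Suc (Suc i'))" using C_deg2[of i'] i that by (auto simp: C_def)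
    then show ?thesis using C_S by auto
  qed

  obtain d :: "'a \<Rightarrow> nat" where d: "d (C 0) = 0"
    "\<And>x y. E x y \<Longrightarrow> {x, y} \<noteq> {C h, C (Suc h)} \<Longrightarrow> d x = Suc (d y) \<or> d y = Suc (d x)"
    "\<And>x y z. E x y \<Longrightarrow> E x z \<Longrightarrow> {x, y} \<noteq> {C h, C (Suc h)} \<Longrightarrow> {x, z} \<noteq> {C h, C (Suc h)} \<Longrightarrow>
      d x = Suc (d y) \<Longrightarrow> d x = Suc (d z) \<Longrightarrow> y = z"
    "even (d (C h) + d (C (Suc h)))"
  proof (rule odd_unicycle_levels[OF G _ Ck C_edge h0])
    show "inj_on C {..<k}" using C_eq by (auto simp: inj_on_def)
  qed (use h h0 in auto)

  have v_step': "E (v (Suc j)) (v (Suc (Suc j))) \<and> v (Suc (Suc j)) \<noteq> v j" if "Suc j < Suc t" for j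
    using v_step[rule_format, of "Suc (Suc j)"] that by simp
  have w_step': "E (w (Suc j)) (w (Suc (Suc j))) \<and> w (Suc (Suc j)) \<noteq> w j" if "Suc j < Suc t" for j
    using w_step[rule_format, of "Suc (Suc j)"] that by simp
  have v_lev: "E (v j) (v (Suc j)) \<and> d (v (Suc j)) = Suc j \<and> d (v j) = j \<and> v (Suc j) \<notin> S"
    if "j < Suc t" for j
  proof (rule branch_levels[where p = "C h" and q = "C (Suc h)" and n = "Suc t"])
    show "d (v 0) = 0" using d(1) v0 C0 by simp
    show "E (v 0) (v 1)" "v 1 \<notin> S" using v0 v1 by (simp_all add: S_def)
    show "y \<in> S" if "x \<in> S" "x \<noteq> v 0" "E x y" for x y using S_closed that v0 by simp
  qed (use sym d(2,3) C_S v_step' that in blast)+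
  have w_lev: "E (w j) (w (Suc j)) \<and> d (w (Suc j)) = Suc j \<and> d (w j) = j \<and> w (Suc j) \<notin> S"
    if "j < Suc t" for j
  proof (rule branch_levels[where p = "C h" and q = "C (Suc h)" and n = "Suc t"])
    show "d (w 0) = 0" using d(1) w0 C0 by simp
    show "E (w 0) (w 1)" "w 1 \<notin> S" using w0 w1 by (simp_all add: S_def)
    show "y \<in> S" if "x \<in> S" "x \<noteq> w 0" "E x y" for x y using S_closed that w0 by simp
  qed (use sym d(2,3) C_S w_step' that in blast)+
  \<comment> \<open>A common vertex of the branches at some level would have a unique lower
    neighbour, so they would already have met one level below; descending reaches
    \<open>v 1 = w 1\<close>. This keeps the reflections at the two ends apart.\<close>
  have vw_ne: "v (Suc j) \<noteq> w (Suc j)" if "j < Suc t" for j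
    using that
  proof (induction j)
    case (Suc j)
    show ?case
    proof
      assume eq: "v (Suc (Suc j)) = w (Suc (Suc j))"
      have "v (Suc (Suc j)) \<notin> S" using v_lev Suc.prems by blast
      then have ne: "{v (Suc (Suc j)), y} \<noteq> {C h, C (Suc h)}" for y
        using C_S[of h] C_S[of "Suc h"] by (auto simp: doubleton_eq_iff)
      have "v (Suc j) = w (Suc j)"
      proof (rule d(3)[OF _ _ ne ne])
        show "E (v (Suc (Suc j))) (v (Suc j))" "E (v (Suc (Suc j))) (w (Suc j))"
          using v_lev[OF Suc.prems] w_lev[OF Suc.prems] eq by (auto intro: sym)
        show "d (v (Suc (Suc j))) = Suc (d (v (Suc j)))" "d (v (Suc (Suc j))) = Suc (d (w (Suc j)))"
          using v_lev[OF Suc.prems] w_lev[OF Suc.prems] by simp_all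
      qed
      with Suc show False by simp
    qed
  qed (use vw in simp)
  have v_path: "{y. E (v (Suc i)) y} = {v i, v (Suc (Suc i))} \<and> v i \<noteq> v (Suc (Suc i))"
    if "i < t" for i
    using nbrs_deg2[of E "v (Suc i)" "v i" "v (Suc (Suc i))"] deg_v[rule_format, of "Suc i"]
      v_lev[of i] v_step'[of i] sym that by auto
  have w_path: "{y. E (w (Suc i)) y} = {w i, w (Suc (Suc i))} \<and> w i \<noteq> w (Suc (Suc i))"
    if "i < t" for i
    using nbrs_deg2[of E "w (Suc i)" "w i" "w (Suc (Suc i))"] deg_w[rule_format, of "Suc i"]
      w_lev[of i] w_step'[of i] sym that by auto

  define X where "X = evolve E (\<lambda>a b. ind (C h) (C (Suc h)) a b + ind (C (Suc h)) (C h) a b)"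
  have X_Suc: "X (Suc n) = step E (X n)" for n by (simp add: X_def)
  have nbrs_u: "{y. E (c 0) y} = {C 1, C (2 * h), v 1, w 1}"
    and dist_u: "distinct [C 1, C (2 * h), v 1, w 1]"
  proof -
    show dist: "distinct [C 1, C (2 * h), v 1, w 1]"
      using C_eq[of 1 "2 * h"] h h0 vw v1 w1 C_S[of 1] C_S[of "2 * h"] by (auto simp: S_def)
    have "E (c 0) (C (2 * h))" using C_edge[of "2 * h"] sym h Ck C0 by simp
    moreover have "E (c 0) (C 1)" using C_edge[of 0] k C0 by simp
    ultimately have "{C 1, C (2 * h), v 1, w 1} \<subseteq> {y. E (c 0) y}" using v1 w1 by auto
    moreover have "card {C 1, C (2 * h), v 1, w 1} = card {y. E (c 0) y}"
      using dist deg_u by (simp add: deg_def)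
    ultimately show "{y. E (c 0) y} = {C 1, C (2 * h), v 1, w 1}"
      using fin_nbrs by (metis card_subset_eq)
  qed
  have step_u: "step E x (c 0) b =
      (x (C 1) (c 0) + x (C (2 * h)) (c 0) + x (v 1) (c 0) + x (w 1) (c 0)) / 2 - x b (c 0)" for x b
    unfolding step_def nbrs_u deg_u using dist_u by (simp add: add.assoc)

  have other_edge: "{C j, C (Suc j)} \<noteq> {C h, C (Suc h)}" if "j < k" "j \<noteq> h" for j
  proof
    assume "{C j, C (Suc j)} = {C h, C (Suc h)}"
    then have "C j = C h \<or> (C j = C (Suc h) \<and> C (Suc j) = C h)"
      by (auto simp: doubleton_eq_iff)
    with that have "j = Suc h" and Suc_j: "C (Suc j) = C h"
      using C_eq[of j h] C_eq[of j "Suc h"] h h0 by auto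
    show False
    proof (cases "Suc j = k")
      case True
      then show ?thesis using Suc_j Ck C_eq[of 0 h] h h0 by simp
    next
      case False
      then show ?thesis using Suc_j \<open>j = Suc h\<close> that(1) C_eq[of "Suc j" h] by simp
    qed
  qed
  have X0_eq: "X 0 a b = ind (C h) (C (Suc h)) a b + ind (C (Suc h)) (C h) a b" for a b
    by (simp only: X_def evolve.simps)
  have X_0: "X 0 a b = 0" if "{a, b} \<noteq> {C h, C (Suc h)}" for a b
  proof -
    have "\<not> (a = C h \<and> b = C (Suc h))" "\<not> (a = C (Suc h) \<and> b = C h)"
      using that by (metis insert_commute)+
    then show ?thesis by (simp only: X0_eq ind_def if_False add_0)
  qed
  have X0_swap: "X 0 a b = X 0 b a" for a b
    unfolding X0_eq by (subst (1 2) ind_swap) (rule add.commute)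
  \<comment> \<open>This is the reflection \<open>C i\<close> to \<open>C (k - i)\<close>, which
    fixes \<open>u\<close>. At \<open>u\<close> the two outgoing cycle arcs share the averaged sum
    and differ only in the subtracted incoming amplitudes, which agree by induction at index
    \<open>2 * h\<close>.\<close>
  have X_sym: "X n (C i) (C (Suc i)) = X n (C (k - i)) (C (k - Suc i))" if "i < k" for n i
    using that
  proof (induction n arbitrary: i)
    case 0
    show ?case
    proof (cases "i = h")
      case True
      then have "k - i = Suc h" "k - Suc i = h" using h by simp_all
      with True show ?thesis using X0_swap by metis
    next
      case False
      define l where "l = k - Suc i"
      have l: "k - i = Suc l" "l < k" "l \<noteq> h" using 0 False h by (auto simp: l_def)
      have "{C (Suc l), C l} \<noteq> {C h, C (Suc h)}"
        using other_edge[OF l(2,3)] by (metis insert_commute)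
      then show ?thesis
        unfolding l(1) l_def[symmetric] using X_0 other_edge[OF 0 False] by metis
    qed
  next
    case (Suc n)
    show ?case
    proof (cases i)
      case 0
      have "X n (C 1) (c 0) = X n (C (2 * h)) (c 0)"
        using Suc.IH[of "2 * h"] h Ck C0 by simp
      then show ?thesis using 0 h Ck C0 by (simp add: X_Suc step_u)
    next
      case (Suc i')
      have "X (Suc n) (C i) (C (Suc i)) = X n (C i') (C i)"
        using C_deg2[of i'] Suc \<open>i < k\<close> unfolding X_Suc by (intro step_deg2) auto
      moreover obtain l where l: "k - i = Suc l" "Suc l < k" using \<open>i < k\<close> Suc
        by (metis Suc_diff_Suc diff_less zero_less_Suc less_trans)
      have l': "k - Suc i = l" "k - i' = Suc (Suc l)" using l Suc by simp_all
      have "X (Suc n) (C (k - i)) (C (k - Suc i)) = X n (C (k - i')) (C (k - i))"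
        unfolding X_Suc l(1) l' by (rule step_deg2) (use C_deg2[OF l(2)] in \<open>metis insert_commute\<close>)+
      ultimately show ?thesis using Suc.IH[of i'] Suc \<open>i < k\<close> by simp
    qed
  qed
  have X_mid: "X n (C h) (C (Suc h)) = X n (C (Suc h)) (C h)" for n
    using X_sym[of h n] h by simp
  have mid: "E (C h) (C (Suc h))" using C_edge[of h] h by simp
  have odd_lev: "odd (d x + d y)" if "E x y" "{x, y} \<noteq> {C h, C (Suc h)}" for x y
    using d(2)[OF that] by auto
  have int: "X n (C h) (C (Suc h)) \<in> \<int>" for n
    by (rule evolve_return_integral[OF simple per mid odd_lev d(4) X_def X_mid])

  \<comment> \<open>From the two arcs of the middle edge the pulses run apart, one along increasing
    and one along decreasing indices, and after \<open>h\<close> steps both are on arcs entering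
    \<open>u\<close>.\<close>
  have at_u: "X h a b = ind (C (2 * h)) (c 0) a b + ind (C 1) (c 0) a b" if "E a b" for a b
  proof -
    have "X (0 + h) a b = ind (C (h + h)) (C (h + Suc h)) a b +
        ind (C (Suc h - h)) (C (Suc h - Suc h)) a b"
    proof (rule deg2_path_pulses[where E = E and X = X and j = 0 and n = h
          and P = "\<lambda>i. C (h + i)" and Q = "\<lambda>i. C (Suc h - i)"])
      show "deg2_path E (\<lambda>i. C (h + i)) h"
        using C_deg2[of "h + _"] h by (auto simp: deg2_path_def)
      show "deg2_path E (\<lambda>i. C (Suc h - i)) h"
        unfolding deg2_path_def
      proof (intro allI impI)
        fix i assume "i < h"
        then obtain l where l: "Suc h - i = Suc (Suc l)" "Suc h - Suc i = Suc l" "Suc h - Suc (Suc i) = l"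
          "Suc l < k"
          using h by (intro that[of "h - Suc i"]) auto
        show "{y. E (C (Suc h - Suc i)) y} = {C (Suc h - i), C (Suc h - Suc (Suc i))} \<and>
            C (Suc h - i) \<noteq> C (Suc h - Suc (Suc i))"
          unfolding l using C_deg2[OF l(4)] by auto
      qed
    next
      show "X 0 x y = ind (C (h + 0)) (C (h + 1)) x y + ind (C (Suc h - 0)) (C (Suc h - 1)) x y" for x y
        unfolding X0_eq by simp
    qed (use sym that X_Suc in auto)
    then show ?thesis using h Ck C0 by (simp add: mult_2)
  qed
  \<comment> \<open>Two unit pulses entering a vertex of degree 4 send \<open>2 / 4 * 2 = 1\<close>
    into every outgoing arc; subtracting the incoming 1 cancels this on the cycle arcs, leaving
    exactly the two branches.\<close>
  have out_u: "X (Suc h) a b = ind (v 0) (v 1) a b + ind (w 0) (w 1) a b" if "E a b" for a b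
  proof -
    have "X (Suc h) a b = step E (\<lambda>a b. ind (C (2 * h)) (c 0) a b + ind (C 1) (c 0) a b) a b"
      unfolding X_Suc using at_u sym that by (intro step_cong) auto
    also have "\<dots> = ind (v 0) (v 1) a b + ind (w 0) (w 1) a b"
    proof (cases "a = c 0")
      case True
      then have "b \<in> {C 1, C (2 * h), v 1, w 1}" using nbrs_u that by auto
      then show ?thesis using dist_u True v0 w0 by (auto simp: step_u ind_def)
    next
      case False
      then show ?thesis using v0 w0 by (auto simp: step_def ind_def)
    qed
    finally show ?thesis .
  qed
  have at_end: "X (Suc h + t) a b = ind (v t) (v (Suc t)) a b + ind (w t) (w (Suc t)) a b"
    if "E a b" for a b
    using sym that v_path w_path out_u
    by (intro deg2_path_pulses[where E = E and X = X]) (auto simp: deg2_path_def X_Suc)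
  \<comment> \<open>\<open>r\<close> and \<open>r'\<close> are the reflection coefficients, that is
    the entries of \<open>U\<close> between an arc and its reversal, at the ends of the
    branches.\<close>
  define r where "r = 2 / complex_of_nat (deg E (v (Suc t))) - 1"
  define r' where "r' = 2 / complex_of_nat (deg E (w (Suc t))) - 1"
  have reflect: "X (Suc (Suc h + t)) (v (Suc t)) (v t) = r"
    "X (Suc (Suc h + t)) (w (Suc t)) (w t) = r'"
  proof -
    have nb: "E (v (Suc t)) (v t)" "E (w (Suc t)) (w t)" "v (Suc t) \<noteq> w (Suc t)"
      using v_lev[of t] w_lev[of t] sym vw_ne[of t] by auto
    have "step E (X (Suc h + t)) a b =
        step E (\<lambda>a b. ind (v t) (v (Suc t)) a b + ind (w t) (w (Suc t)) a b) a b" if "E a b" for a b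
      using at_end sym that by (intro step_cong) auto
    then show "X (Suc (Suc h + t)) (v (Suc t)) (v t) = r"
      "X (Suc (Suc h + t)) (w (Suc t)) (w t) = r'"
      using nb fin_nbrs by (simp_all add: X_Suc step_add, simp_all add: step_def ind_def r_def r'_def)
  qed
  \<comment> \<open>What is transmitted beyond the ends is unknown by now, so only the reflected
    amplitude on a single arc is followed, along the reversed branch.\<close>
  have returned: "X (Suc (Suc h + t) + t) (v 1) (c 0) = r" "X (Suc (Suc h + t) + t) (w 1) (c 0) = r'"
  proof -
    have rev: "deg2_path E (\<lambda>i. z (Suc t - i)) t"
      if "\<And>i. i < t \<Longrightarrow> {y. E (z (Suc i)) y} = {z i, z (Suc (Suc i))} \<and> z i \<noteq> z (Suc (Suc i))"
      for z :: "nat \<Rightarrow> 'a"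
      unfolding deg2_path_def
    proof (intro allI impI)
      fix i assume "i < t"
      then obtain l where l: "Suc t - i = Suc (Suc l)" "Suc t - Suc i = Suc l"
        "Suc t - Suc (Suc i) = l" "l < t"
        by (intro that[of "t - Suc i"]) auto
      show "{y. E (z (Suc t - Suc i)) y} = {z (Suc t - i), z (Suc t - Suc (Suc i))} \<and>
          z (Suc t - i) \<noteq> z (Suc t - Suc (Suc i))"
        unfolding l using that[OF l(4)] by auto
    qed
    show "X (Suc (Suc h + t) + t) (v 1) (c 0) = r"
    proof -
      have "deg2_path E (\<lambda>i. v (Suc t - i)) t" by (rule rev) (rule v_path)
      from deg2_path_transport[where X = X, OF X_Suc this, of "Suc (Suc h + t)"]
      show ?thesis using reflect v0 by simp
    qed
    show "X (Suc (Suc h + t) + t) (w 1) (c 0) = r'"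
    proof -
      have "deg2_path E (\<lambda>i. w (Suc t - i)) t" by (rule rev) (rule w_path)
      from deg2_path_transport[where X = X, OF X_Suc this, of "Suc (Suc h + t)"]
      show ?thesis using reflect w0 by simp
    qed
  qed
  let ?n = "Suc (Suc (Suc h + t) + t)"
  \<comment> \<open>The amplitudes arriving at \<open>u\<close> from the cycle are equal by
    \<open>X_sym\<close>: half their sum cancels against the subtracted term, so their values need
    not be known.\<close>
  have "X ?n (c 0) (C 1) = (r + r') / 2"
  proof -
    have "X n (C 1) (c 0) = X n (C (2 * h)) (c 0)" for n
      using X_sym[of "2 * h" n] h Ck C0 by simp
    then show ?thesis unfolding X_Suc step_u returned by (simp add: field_simps)
  qed
  moreover have "deg2_path E C h" using C_deg2 h by (auto simp: deg2_path_def)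
  \<comment> \<open>The total time \<open>?n + h\<close> is
    \<open>2 * h + 2 * t + 3 = k + 2 * (t + 1)\<close>.\<close>
  then have "X (?n + h) (C h) (C (Suc h)) = X ?n (C 0) (C 1)"
    using deg2_path_transport[where X = X, OF X_Suc] by blast
  ultimately have "(r + r') / 2 \<in> \<int>" using int[of "?n + h"] C0 by metis
  then have "(r + r') / 2 + 1 \<in> \<int>" by (intro Ints_add) auto
  moreover have "(r + r') / 2 + 1 =
      1 / of_nat (deg E (v (Suc t))) + 1 / of_nat (deg E (w (Suc t)))"
    by (simp add: r_def r'_def field_simps)
  moreover have pos: "deg E (v (Suc t)) > 0" "deg E (w (Suc t)) > 0"
    using v_lev[of t] w_lev[of t] sym fin_nbrs by (auto simp: deg_def card_gt_0_iff)
  ultimately show ?thesis using unit_fractions_sum_integral by (metis Suc_eq_plus1)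
qed

end
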